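(* Let $\ell\ge 2$ be an integer. The binary codes $K(\ell,\ell-1,\ell-2)$ and $\mathcal{H}_\ell$ are permutation equivalent, i.e. one is obtained from the other by a permutation of the coordinates.
   Context: For integers $0\le h\le \ell$ and $j\ge 0$, let $P=\{p_1,\dots,p_n\}\subseteq \mathbb{F}_2^\ell$ be the set of all vectors having at most $h$ nonzero entries. The $h$-skeleton code $K(\ell,h,j)\subseteq \mathbb{F}_2^n$ is the image of the linear map $f\mapsto (f(p_1),\dots,f(p_n))$ defined on the space of all polynomials of total degree at most $j$ in $\mathbb{F}_2[x_1,\dots,x_\ell]$. $\mathcal{H}_\ell$ denotes the $\ell$-th binary Hamming code: the linear code of length $2^\ell-1$ whose parity check matrix is the $\ell\times(2^\ell-1)$ matrix whose columns are all the nonzero vectors of $\mathbb{F}_2^\ell$. *)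

theory Defs
  imports
    "HOL-Library.Z2"
    "HOL-Library.Poly_Mapping"
    "Jordan_Normal_Form.Matrix_Kernel"
begin

text \<open>
  The field with two elements is \<^typ>\<open>bit\<close>. A polynomial over it is a finitely supported map
  from monomials to coefficients, and a monomial is a finitely supported map from variable
  indices to exponents. Coordinates and variables are numbered from 0, so \<open>x\<^sub>1, \<dots>, x\<^sub>\<ell>\<close> are the
  variables with index in \<open>{..<\<ell>}\<close>.
\<close>

type_synonym monomial = "nat \<Rightarrow>\<^sub>0 nat"
type_synonym f2_poly = "monomial \<Rightarrow>\<^sub>0 bit"

definition monomial_degree :: "monomial \<Rightarrow> nat" where
  "monomial_degree m = (\<Sum>i\<in>Poly_Mapping.keys m. Poly_Mapping.lookup m i)"

text \<open>The zero polynomial is given total degree 0, so that it lies in every \<open>polys_deg_le\<close> below.\<close>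

definition total_degree :: "f2_poly \<Rightarrow> nat" where
  "total_degree f = Max (insert 0 (monomial_degree ` Poly_Mapping.keys f))"

definition polys_deg_le :: "nat \<Rightarrow> nat \<Rightarrow> f2_poly set" where
  "polys_deg_le l j =
     {f. (\<forall>m\<in>Poly_Mapping.keys f. Poly_Mapping.keys m \<subseteq> {..<l}) \<and> total_degree f \<le> j}"

definition poly_eval :: "f2_poly \<Rightarrow> bit vec \<Rightarrow> bit" where
  "poly_eval f p = (\<Sum>m\<in>Poly_Mapping.keys f. Poly_Mapping.lookup f m *
     (\<Prod>i\<in>Poly_Mapping.keys m. (p $ i) ^ Poly_Mapping.lookup m i))"

definition skeleton_points :: "nat \<Rightarrow> nat \<Rightarrow> bit vec set" where
  "skeleton_points l h = {p \<in> carrier_vec l. card {i. i < l \<and> p $ i \<noteq> 0} \<le> h}"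

text \<open>
  Both codes depend on an order of their coordinates that the mathematics leaves open; it is
  passed explicitly as an enumeration without repetitions.
\<close>

definition enumerates :: "'a list \<Rightarrow> 'a set \<Rightarrow> bool" where
  "enumerates xs A \<longleftrightarrow> distinct xs \<and> set xs = A"

text \<open>
  If \<open>ps = [p\<^sub>1, \<dots>, p\<^sub>n]\<close> enumerates \<open>skeleton_points l h\<close>, then \<open>skeleton_code l j ps\<close> is
  \<open>K(l, h, j)\<close>; the parameter \<open>h\<close> enters only through \<open>ps\<close>.
\<close>

definition skeleton_code :: "nat \<Rightarrow> nat \<Rightarrow> bit vec list \<Rightarrow> bit vec set" where
  "skeleton_code l j ps = (\<lambda>f. vec_of_list (map (poly_eval f) ps)) ` polys_deg_le l j"

text \<open>
  If \<open>cs\<close> enumerates the nonzero vectors of length \<open>l\<close>, then \<open>hamming_code l cs\<close> is the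
  \<open>l\<close>-th binary Hamming code.
\<close>

definition hamming_code :: "nat \<Rightarrow> bit vec list \<Rightarrow> bit vec set" where
  "hamming_code l cs = mat_kernel (mat_of_cols l cs)"

definition permutation_equivalent :: "'a vec set \<Rightarrow> 'a vec set \<Rightarrow> bool" where
  "permutation_equivalent C D \<longleftrightarrow>
     (\<exists>n \<pi>. C \<subseteq> carrier_vec n \<and> D \<subseteq> carrier_vec n \<and> \<pi> permutes {..<n} \<and>
        D = (\<lambda>v. vec n (\<lambda>i. v $ \<pi> i)) ` C)"

end

theory Submission
  imports Defs "HOL-Combinatorics.Permutations"
begin

text \<open>
  The points of the skeleton are all points of the cube except the all-ones vector, and
  complementing the entries takes them to the columns of the parity check matrix. Identify a point
  with its support \<open>T\<close>. A function \<open>h\<close> on supports then satisfies the Hamming checks iff its sum over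
  the subsets of \<open>{..<l} - {i}\<close> vanishes for every \<open>i < l\<close>. A value at the missing point can be
  chosen freely, so that also the sum over all subsets of \<open>{..<l}\<close> vanishes. By Moebius inversion over
  the field with two elements, the sum of \<open>h\<close> over the subsets of \<open>S\<close> is the coefficient at
  \<open>\<Prod>i\<in>S. x\<^sub>i\<close> of the multilinear polynomial that interpolates \<open>h\<close>; hence the two conditions
  together say that this polynomial has degree at most \<open>l - 2\<close>.
\<close>

section \<open>Sums over subset lattices in characteristic two\<close>

lemma bit_add_self: "x + x = (0::bit)"
  by (cases x) simp_all

text \<open>The sets between \<open>A\<close> and \<open>B\<close> arise from \<open>A\<close> by
  adding an arbitrary subset of \<open>B - A\<close>, so their number is a power of two: even unless
  \<open>A = B\<close>. If \<open>A\<close> is not contained in \<open>B\<close>, there are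
  none.\<close>

lemma sum_interval_bit:
  fixes A B :: "'a set"
  assumes "finite B"
  shows "(\<Sum>S\<in>Pow B. if A \<subseteq> S then 1 else (0::bit)) = (if A = B then 1 else 0)"
proof (cases "A \<subseteq> B")
  case False
  then have "\<And>S. S \<in> Pow B \<Longrightarrow> \<not> A \<subseteq> S" by blast
  with False show ?thesis by auto
next
  case True
  have inj: "inj_on (\<lambda>U. A \<union> U) (Pow (B - A))"
    by (auto simp: inj_on_def)
  have img: "{S \<in> Pow B. A \<subseteq> S} = (\<lambda>U. A \<union> U) ` Pow (B - A)" (is "?L = ?R")
  proof
    show "?L \<subseteq> ?R"
    proof
      fix S assume S: "S \<in> ?L"
      then have "S = A \<union> (S - A)" "S - A \<in> Pow (B - A)" by auto
      then show "S \<in> ?R" by (rule image_eqI)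
    qed
    show "?R \<subseteq> ?L" using True by auto
  qed
  have "(\<Sum>S\<in>Pow B. if A \<subseteq> S then 1 else (0::bit)) = (\<Sum>S\<in>{S \<in> Pow B. A \<subseteq> S}. 1)"
    using assms by (subst sum.inter_filter) auto
  also have "\<dots> = of_nat (card (Pow (B - A)))"
    unfolding img by (simp add: card_image[OF inj])
  \<comment> \<open>The count is a power of 2, and 2 is 0 in the field; the convention that
    \<open>0 ^ 0\<close> is 1 then singles out \<open>A = B\<close>.\<close>
  also have "\<dots> = (0::bit) ^ card (B - A)"
    using assms by (simp add: card_Pow)
  also have "\<dots> = (if A = B then 1 else 0)"
    using assms True by (auto simp: power_0_left)
  finally show ?thesis .
qed

text \<open>After exchanging the sums, \<open>h U\<close> is weighted by the parity of the number of
  sets between \<open>U\<close> and \<open>T\<close>, which is odd only for \<open>U = T\<close>.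
  The usual Moebius signs disappear because -1 = 1, so summation over subsets is its own
  inverse.\<close>

lemma moebius_inversion_bit:
  fixes h :: "'a set \<Rightarrow> bit"
  assumes "finite T"
  shows "(\<Sum>S\<in>Pow T. \<Sum>U\<in>Pow S. h U) = h T"
proof -
  have "(\<Sum>S\<in>Pow T. \<Sum>U\<in>Pow S. h U) = (\<Sum>S\<in>Pow T. \<Sum>U\<in>Pow T. if U \<subseteq> S then h U else 0)"
  proof (rule sum.cong[OF refl])
    fix S assume "S \<in> Pow T"
    then have "Pow S = {U \<in> Pow T. U \<subseteq> S}" by auto
    then show "(\<Sum>U\<in>Pow S. h U) = (\<Sum>U\<in>Pow T. if U \<subseteq> S then h U else 0)"
      using assms by (simp only: sum.inter_filter finite_Pow_iff)
  qed
  also have "\<dots> = (\<Sum>U\<in>Pow T. \<Sum>S\<in>Pow T. if U \<subseteq> S then h U else 0)"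
    by (rule sum.swap)
  also have "\<dots> = (\<Sum>U\<in>Pow T. h U * (\<Sum>S\<in>Pow T. if U \<subseteq> S then 1 else 0))"
    unfolding sum_distrib_left by (intro sum.cong refl) simp
  also have "\<dots> = (\<Sum>U\<in>Pow T. if U = T then h U else 0)"
    using assms by (simp add: sum_interval_bit if_distrib cong: if_cong)
  also have "\<dots> = h T"
    using assms by (simp add: sum.delta)
  finally show ?thesis .
qed

section \<open>Polynomials as functions on supports\<close>

text \<open>The value of \<open>f\<close> at the indicator vector of \<open>T\<close>: nonzero
  coefficients are 1, and positive exponents have no effect on the values 0 and 1. It makes sense
  also at the full set, the point that the skeleton lacks.\<close>

definition set_eval :: "f2_poly \<Rightarrow> nat set \<Rightarrow> bit" where
  "set_eval f T = (\<Sum>m\<in>Poly_Mapping.keys f. if Poly_Mapping.keys m \<subseteq> T then 1 else 0)"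

text \<open>The hypothesis is limited to variables that occur in \<open>f\<close>, because entries
  of \<open>p\<close> beyond its dimension are unspecified.\<close>

lemma poly_eval_eq_set_eval:
  assumes "\<And>m i. m \<in> Poly_Mapping.keys f \<Longrightarrow> i \<in> Poly_Mapping.keys m \<Longrightarrow> p $ i = (if i \<in> T then 1 else 0)"
  shows "poly_eval f p = set_eval f T"
  unfolding poly_eval_def set_eval_def
proof (rule sum.cong[OF refl])
  fix m assume m: "m \<in> Poly_Mapping.keys f"
  then have "Poly_Mapping.lookup f m = 1"
    by (simp add: in_keys_iff)
  moreover have "(\<Prod>i\<in>Poly_Mapping.keys m. (p $ i) ^ Poly_Mapping.lookup m i)
      = (\<Prod>i\<in>Poly_Mapping.keys m. if i \<in> T then 1 else 0)"
    by (rule prod.cong) (auto simp: assms[OF m] in_keys_iff)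
  moreover have "\<dots> = (if Poly_Mapping.keys m \<subseteq> T then 1 else (0::bit))"
    by (auto simp: prod_zero_iff intro!: prod.neutral)
  ultimately show "Poly_Mapping.lookup f m * (\<Prod>i\<in>Poly_Mapping.keys m. (p $ i) ^ Poly_Mapping.lookup m i)
      = (if Poly_Mapping.keys m \<subseteq> T then 1 else 0)"
    by simp
qed

lemma card_keys_le_monomial_degree: "card (Poly_Mapping.keys m) \<le> monomial_degree m"
proof -
  have "(\<Sum>i\<in>Poly_Mapping.keys m. 1) \<le> (\<Sum>i\<in>Poly_Mapping.keys m. Poly_Mapping.lookup m i)"
    by (rule sum_mono) (simp add: in_keys_iff Suc_le_eq)
  then show ?thesis by (simp add: monomial_degree_def)
qed

lemma total_degree_le_iff:
  "total_degree f \<le> j \<longleftrightarrow> (\<forall>m\<in>Poly_Mapping.keys f. monomial_degree m \<le> j)"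
  by (simp add: total_degree_def)

text \<open>A monomial contributes the parity of the number of sets between its set of variables and
  \<open>B\<close>. This is nonzero only if it involves exactly the variables in \<open>B\<close>,
  which are too many for degree \<open>j\<close>.\<close>

lemma sum_set_eval_Pow_eq_0:
  assumes "f \<in> polys_deg_le l j" and "finite B" and "j < card B"
  shows "(\<Sum>T\<in>Pow B. set_eval f T) = 0"
proof -
  have "(\<Sum>T\<in>Pow B. set_eval f T)
      = (\<Sum>m\<in>Poly_Mapping.keys f. \<Sum>T\<in>Pow B. if Poly_Mapping.keys m \<subseteq> T then 1 else 0)"
    unfolding set_eval_def by (rule sum.swap)
  also have "\<dots> = 0"
  proof (rule sum.neutral, rule ballI)
    fix m assume "m \<in> Poly_Mapping.keys f"
    then have "card (Poly_Mapping.keys m) \<le> j"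
      using assms(1) card_keys_le_monomial_degree[of m]
      by (auto simp: polys_deg_le_def total_degree_le_iff intro: le_trans)
    then show "(\<Sum>T\<in>Pow B. if Poly_Mapping.keys m \<subseteq> T then 1 else (0::bit)) = 0"
      using assms(2,3) by (auto simp: sum_interval_bit)
  qed
  finally show ?thesis .
qed

section \<open>Multilinear interpolation\<close>

definition squarefree_monomial :: "nat set \<Rightarrow> monomial" where
  "squarefree_monomial S = Poly_Mapping.Abs_poly_mapping (\<lambda>i. if i \<in> S then 1 else 0)"

lemma lookup_squarefree_monomial:
  assumes "finite S"
  shows "Poly_Mapping.lookup (squarefree_monomial S) i = (if i \<in> S then 1 else 0)"
proof -
  have "finite {i. (if i \<in> S then 1 else (0::nat)) \<noteq> 0}"
    using assms by simp
  then show ?thesis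
    by (simp add: squarefree_monomial_def Abs_poly_mapping_inverse)
qed

lemma keys_squarefree_monomial: "finite S \<Longrightarrow> Poly_Mapping.keys (squarefree_monomial S) = S"
  by (auto simp: in_keys_iff lookup_squarefree_monomial split: if_splits)

lemma monomial_degree_squarefree_monomial:
  "finite S \<Longrightarrow> monomial_degree (squarefree_monomial S) = card S"
  by (simp add: monomial_degree_def keys_squarefree_monomial lookup_squarefree_monomial)

lemma ex_f2_poly_keys:
  assumes "finite M"
  shows "\<exists>f :: f2_poly. Poly_Mapping.keys f = M"
proof
  show "Poly_Mapping.keys (Poly_Mapping.Abs_poly_mapping (\<lambda>m. if m \<in> M then 1 else 0) :: f2_poly) = M"
    using assms by (auto simp: in_keys_iff Abs_poly_mapping_inverse split: if_splits)
qed

text \<open>The multilinear polynomial with the subset sums of \<open>h\<close> as coefficients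
  takes the values of \<open>h\<close> by Moebius inversion. The hypothesis says that its
  coefficients above degree \<open>j\<close> vanish.\<close>

lemma ex_poly_interpolating:
  fixes h :: "nat set \<Rightarrow> bit"
  assumes "\<And>S. S \<subseteq> {..<l} \<Longrightarrow> j < card S \<Longrightarrow> (\<Sum>U\<in>Pow S. h U) = 0"
  shows "\<exists>f\<in>polys_deg_le l j. \<forall>T\<subseteq>{..<l}. set_eval f T = h T"
proof -
  let ?a = "\<lambda>S. \<Sum>U\<in>Pow S. h U"
  \<comment> \<open>The supports of the monomials with coefficient 1; over this field they determine
    the polynomial.\<close>
  define A where "A = {S. S \<subseteq> {..<l} \<and> ?a S = 1}"
  have fin: "finite S" if "S \<subseteq> {..<l}" for S
    using that by (rule finite_subset) simp
  have keysA: "Poly_Mapping.keys (squarefree_monomial S) = S" if "S \<in> A" for S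
    using that by (simp add: A_def keys_squarefree_monomial fin)
  have "finite A"
    unfolding A_def by simp
  then have "\<exists>f :: f2_poly. Poly_Mapping.keys f = squarefree_monomial ` A"
    by (intro ex_f2_poly_keys finite_imageI)
  then obtain f :: f2_poly where f: "Poly_Mapping.keys f = squarefree_monomial ` A"
    by (rule exE)
  show ?thesis
  proof (intro bexI allI impI)
    show "f \<in> polys_deg_le l j"
      unfolding polys_deg_le_def mem_Collect_eq total_degree_le_iff f
    proof safe
      fix S i assume "S \<in> A" "i \<in> Poly_Mapping.keys (squarefree_monomial S)"
      then show "i < l" by (auto simp: keysA A_def)
    next
      fix S assume S: "S \<in> A"
      then have "\<not> j < card S" using assms[of S] by (auto simp: A_def)
      with S show "monomial_degree (squarefree_monomial S) \<le> j"
        by (simp add: A_def monomial_degree_squarefree_monomial fin)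
    qed
  next
    fix T assume T: "T \<subseteq> {..<l}"
    \<comment> \<open>Different supports give different monomials, so the sum over the monomials of
      \<open>f\<close> can be taken over \<open>A\<close>.\<close>
    have "inj_on squarefree_monomial A"
      by (metis inj_onI keysA)
    then have "set_eval f T = (\<Sum>S\<in>A. if S \<subseteq> T then 1 else 0)"
      unfolding set_eval_def f by (simp add: sum.reindex keysA)
    also have "\<dots> = (\<Sum>S\<in>Pow T. ?a S)"
    proof -
      have "(\<Sum>S\<in>Pow T. ?a S) = (\<Sum>S\<in>Pow T. if S \<in> A then 1 else 0)"
        using T by (intro sum.cong refl) (auto simp: A_def)
      also have "\<dots> = (\<Sum>S\<in>A \<inter> Pow T. 1)"
        using \<open>finite A\<close> fin[OF T] by (simp add: sum.If_cases Int_commute)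
      also have "\<dots> = (\<Sum>S\<in>A. if S \<subseteq> T then 1 else 0)"
        using \<open>finite A\<close> by (simp add: sum.If_cases Pow_def)
      finally show ?thesis by simp
    qed
    also have "\<dots> = h T"
      by (rule moebius_inversion_bit[OF fin[OF T]])
    finally show "set_eval f T = h T" .
  qed
qed

section \<open>Matching skeleton points with parity check columns\<close>

text \<open>This is the support of \<open>complement_vec c\<close>, so it labels a column of the
  parity check matrix by the support of the matching skeleton point.\<close>

definition zero_set :: "bit vec \<Rightarrow> nat set" where
  "zero_set c = {i. i < dim_vec c \<and> c $ i = 0}"

definition complement_vec :: "bit vec \<Rightarrow> bit vec" where
  "complement_vec c = vec (dim_vec c) (\<lambda>i. c $ i + 1)"

lemma complement_vec_involution [simp]: "complement_vec (complement_vec c) = c"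
  by (rule eq_vecI) (simp_all add: complement_vec_def add.assoc bit_add_self del: one_add_one)

lemma complement_vec_carrier [simp]:
  "complement_vec c \<in> carrier_vec l \<longleftrightarrow> c \<in> carrier_vec l"
proof -
  have "dim_vec (complement_vec c) = dim_vec c" by (simp add: complement_vec_def)
  then show ?thesis by (metis carrier_vecD carrier_vecI)
qed

lemma complement_vec_index:
  "i < dim_vec c \<Longrightarrow> complement_vec c $ i = (if i \<in> zero_set c then 1 else 0)"
  by (cases "c $ i") (simp_all add: complement_vec_def zero_set_def)

text \<open>A vector over this field is determined by its zero set, and the zero vector is the one
  whose zero set is everything.\<close>

lemma bij_betw_zero_set:
  "bij_betw zero_set (carrier_vec l - {0\<^sub>v l}) (Pow {..<l} - {{..<l}})"
proof (rule bij_betw_byWitness[where f' = "\<lambda>T. vec l (\<lambda>i. if i \<in> T then 0 else 1)"])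
  show "\<forall>c\<in>carrier_vec l - {0\<^sub>v l}. vec l (\<lambda>i. if i \<in> zero_set c then 0 else 1) = c"
    by (intro ballI eq_vecI) (auto simp: zero_set_def)
  show "\<forall>T\<in>Pow {..<l} - {{..<l}}. zero_set (vec l (\<lambda>i. if i \<in> T then 0 else 1)) = T"
    by (auto simp: zero_set_def split: if_splits)
  show "zero_set ` (carrier_vec l - {0\<^sub>v l}) \<subseteq> Pow {..<l} - {{..<l}}"
  proof (intro image_subsetI)
    fix c :: "bit vec" assume c: "c \<in> carrier_vec l - {0\<^sub>v l}"
    then obtain i where "i < l" "c $ i \<noteq> 0"
      by (metis Diff_iff carrier_vecD eq_vecI index_zero_vec singletonI)
    then have "i \<in> {..<l}" "i \<notin> zero_set c"
      by (simp_all add: zero_set_def)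
    then have "zero_set c \<noteq> {..<l}" by metis
    with c show "zero_set c \<in> Pow {..<l} - {{..<l}}"
      by (auto simp: zero_set_def)
  qed
  show "(\<lambda>T. vec l (\<lambda>i. if i \<in> T then 0 else (1::bit))) ` (Pow {..<l} - {{..<l}}) \<subseteq> carrier_vec l - {0\<^sub>v l}"
  proof (intro image_subsetI)
    fix T assume T: "T \<in> Pow {..<l} - {{..<l}}"
    then obtain i where i: "i < l" "i \<notin> T" by auto
    then have "vec l (\<lambda>i. if i \<in> T then 0 else (1::bit)) $ i \<noteq> 0\<^sub>v l $ i" by simp
    then show "vec l (\<lambda>i. if i \<in> T then 0 else (1::bit)) \<in> carrier_vec l - {0\<^sub>v l}"
      by (metis Diff_iff singletonD vec_carrier)
  qed
qed

text \<open>Having at most \<open>l - 1\<close> nonzero entries means having some zero entry, hence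
  a nonzero complement. For \<open>l = 0\<close> truncated subtraction would admit the empty vector,
  whose complement is zero.\<close>

lemma complement_skeleton_points:
  assumes "0 < l"
  shows "complement_vec ` skeleton_points l (l - 1) = carrier_vec l - {0\<^sub>v l}"
proof -
  have skel: "p \<in> skeleton_points l (l - 1) \<longleftrightarrow> complement_vec p \<in> carrier_vec l - {0\<^sub>v l}" for p
  proof (cases "p \<in> carrier_vec l")
    case False
    then show ?thesis by (simp add: skeleton_points_def)
  next
    case True
    let ?S = "{i. i < l \<and> p $ i \<noteq> 0}"
    have "card ?S \<le> l - 1 \<longleftrightarrow> ?S \<noteq> {..<l}"
    proof
      assume "card ?S \<le> l - 1"
      then have "card ?S \<noteq> card {..<l}"
        using assms by simp
      then show "?S \<noteq> {..<l}" by metis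
    next
      assume "?S \<noteq> {..<l}"
      then have "card ?S < card {..<l}" by (intro psubset_card_mono) auto
      then show "card ?S \<le> l - 1" by simp
    qed
    also have "\<dots> \<longleftrightarrow> complement_vec p \<noteq> 0\<^sub>v l"
    proof -
      have "p $ i \<noteq> 0 \<longleftrightarrow> p $ i + 1 = 0" for i
        by (cases "p $ i") simp_all
      then have "complement_vec p = 0\<^sub>v l \<longleftrightarrow> (\<forall>i<l. p $ i \<noteq> 0)"
        using True by (simp add: vec_eq_iff complement_vec_def)
      moreover have "?S = {..<l} \<longleftrightarrow> (\<forall>i<l. p $ i \<noteq> 0)"
        by blast
      ultimately show ?thesis by metis
    qed
    finally show ?thesis
      using True by (simp add: skeleton_points_def)
  qed
  show ?thesis
  proof
    show "complement_vec ` skeleton_points l (l - 1) \<subseteq> carrier_vec l - {0\<^sub>v l}"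
      by (intro image_subsetI) (simp only: skel)
    show "carrier_vec l - {0\<^sub>v l} \<subseteq> complement_vec ` skeleton_points l (l - 1)"
    proof
      fix c :: "bit vec" assume "c \<in> carrier_vec l - {0\<^sub>v l}"
      then have "complement_vec c \<in> skeleton_points l (l - 1)" by (simp only: skel complement_vec_involution)
      then show "c \<in> complement_vec ` skeleton_points l (l - 1)"
        by (metis complement_vec_involution image_eqI)
    qed
  qed
qed

section \<open>The Hamming code as a code of polynomial values\<close>

text \<open>Row \<open>i\<close> of the parity check matrix selects the columns with entry 1 at
  \<open>i\<close>, that is, those whose zero set avoids \<open>i\<close>.\<close>

lemma hamming_code_iff:
  assumes "enumerates cs (carrier_vec l - {0\<^sub>v l})"
  shows "vec_of_list (map (\<lambda>c. h (zero_set c)) cs) \<in> hamming_code l cs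
    \<longleftrightarrow> (\<forall>i<l. (\<Sum>T\<in>Pow ({..<l} - {i}). h T) = 0)"
proof -
  have dist: "distinct cs" and set: "set cs = carrier_vec l - {0\<^sub>v l}"
    using assms by (auto simp: enumerates_def)
  let ?v = "vec_of_list (map (\<lambda>c. h (zero_set c)) cs)"
  have entry: "(mat_of_cols l cs *\<^sub>v ?v) $ i = (\<Sum>T\<in>Pow ({..<l} - {i}). h T)" if i: "i < l" for i
  proof -
    have "(mat_of_cols l cs *\<^sub>v ?v) $ i = (\<Sum>k<length cs. cs ! k $ i * h (zero_set (cs ! k)))"
      using i by (auto simp: scalar_prod_def mat_of_cols_index vec_of_list_index
          atLeast0LessThan intro!: sum.cong)
    also have "\<dots> = (\<Sum>c\<in>set cs. c $ i * h (zero_set c))"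
      using dist by (intro sum.reindex_bij_betw bij_betw_nth) auto
    also have "\<dots> = (\<Sum>c\<in>carrier_vec l - {0\<^sub>v l}. if i \<in> zero_set c then 0 else h (zero_set c))"
    proof (rule sum.cong)
      fix c :: "bit vec" assume "c \<in> carrier_vec l - {0\<^sub>v l}"
      then show "c $ i * h (zero_set c) = (if i \<in> zero_set c then 0 else h (zero_set c))"
        using i by (cases "c $ i") (auto simp: zero_set_def)
    qed (rule set)
    also have "\<dots> = (\<Sum>T\<in>Pow {..<l} - {{..<l}}. if i \<in> T then 0 else h T)"
      by (rule sum.reindex_bij_betw[OF bij_betw_zero_set])
    \<comment> \<open>The excluded full set contains \<open>i\<close>, so it is not among the
      subsets on the right.\<close>
    also have "\<dots> = (\<Sum>T\<in>Pow ({..<l} - {i}). h T)"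
      using i by (intro sum.mono_neutral_cong_right) auto
    finally show ?thesis .
  qed
  have "?v \<in> carrier_vec (length cs)"
    by (rule carrier_vecI) simp
  then have "?v \<in> hamming_code l cs \<longleftrightarrow> mat_of_cols l cs *\<^sub>v ?v = 0\<^sub>v l"
    by (simp only: hamming_code_def mat_kernel_def mat_of_cols_carrier mem_Collect_eq
        mat_of_cols_carrier(3) simp_thms)
  also have "\<dots> \<longleftrightarrow> (\<forall>i<l. (mat_of_cols l cs *\<^sub>v ?v) $ i = 0)"
    by (simp only: vec_eq_iff dim_mult_mat_vec mat_of_cols_carrier index_zero_vec) auto
  also have "\<dots> \<longleftrightarrow> (\<forall>i<l. (\<Sum>T\<in>Pow ({..<l} - {i}). h T) = 0)"
    by (intro all_cong) (simp only: entry)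
  finally show ?thesis .
qed

text \<open>The word fixes \<open>h\<close> on proper subsets only. Giving the full set the sum of
  all these values makes the total a sum of two equal terms, hence zero.\<close>

lemma ex_extension_vec:
  fixes v :: "bit vec"
  assumes "enumerates cs (carrier_vec l - {0\<^sub>v l})" and "v \<in> carrier_vec (length cs)"
  obtains h where "v = vec_of_list (map (\<lambda>c. h (zero_set c)) cs)"
    and "(\<Sum>T\<in>Pow {..<l}. h T) = 0"
proof -
  have dist: "distinct cs" and set: "set cs = carrier_vec l - {0\<^sub>v l}"
    using assms by (auto simp: enumerates_def)
  have "bij_betw (\<lambda>k. zero_set (cs ! k)) {..<length cs} (Pow {..<l} - {{..<l}})"
    using bij_betw_trans[OF bij_betw_nth[OF dist refl refl] bij_betw_zero_set[of l, folded set]]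
    by (simp add: comp_def)
  then have inv: "inv_into {..<length cs} (\<lambda>k. zero_set (cs ! k)) (zero_set (cs ! k)) = k"
    and proper: "zero_set (cs ! k) \<in> Pow {..<l} - {{..<l}}" if "k < length cs" for k
    using that by (auto simp: bij_betw_def intro: inv_into_f_f)
  \<comment> \<open>The entry of \<open>v\<close> at the position of the column labelled
    \<open>T\<close>. At the full set, which labels no column, \<open>g\<close> is arbitrary and
    gets overridden in \<open>h\<close>.\<close>
  define g where "g T = v $ inv_into {..<length cs} (\<lambda>k. zero_set (cs ! k)) T" for T
  define h where "h = g({..<l} := (\<Sum>T\<in>Pow {..<l} - {{..<l}}. g T))"
  show ?thesis
  proof
    show "v = vec_of_list (map (\<lambda>c. h (zero_set c)) cs)"
      using assms(2) proper by (intro eq_vecI) (auto simp: vec_of_list_index h_def g_def inv)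
    have "(\<Sum>T\<in>Pow {..<l}. h T) = h {..<l} + (\<Sum>T\<in>Pow {..<l} - {{..<l}}. h T)"
      by (rule sum.remove) auto
    also have "(\<Sum>T\<in>Pow {..<l} - {{..<l}}. h T) = (\<Sum>T\<in>Pow {..<l} - {{..<l}}. g T)"
      by (rule sum.cong) (auto simp: h_def)
    also have "h {..<l} = (\<Sum>T\<in>Pow {..<l} - {{..<l}}. g T)"
      by (simp add: h_def)
    finally show "(\<Sum>T\<in>Pow {..<l}. h T) = 0"
      by (simp only: bit_add_self)
  qed
qed

text \<open>The subsets with more than \<open>l - 2\<close> elements are the full set and the sets
  missing one index. Vanishing of the sum over the former is arranged by the extension; for the
  latter it is the parity checks.\<close>

lemma hamming_code_eq_evaluations:
  assumes "l \<ge> 2" and "enumerates cs (carrier_vec l - {0\<^sub>v l})"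
  shows "hamming_code l cs
    = (\<lambda>f. vec_of_list (map (\<lambda>c. set_eval f (zero_set c)) cs)) ` polys_deg_le l (l - 2)"
proof (intro equalityI subsetI)
  fix v assume v: "v \<in> hamming_code l cs"
  then have "v \<in> carrier_vec (length cs)"
    by (auto simp: hamming_code_def mat_kernel_def)
  then obtain h where h: "v = vec_of_list (map (\<lambda>c. h (zero_set c)) cs)"
    and total: "(\<Sum>T\<in>Pow {..<l}. h T) = 0"
    by (rule ex_extension_vec[OF assms(2)])
  have facet: "(\<Sum>T\<in>Pow ({..<l} - {i}). h T) = 0" if "i < l" for i
    using v that unfolding h hamming_code_iff[OF assms(2)] by blast
  have "(\<Sum>U\<in>Pow S. h U) = 0" if S: "S \<subseteq> {..<l}" "l - 2 < card S" for S
  proof (cases "S = {..<l}")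
    case True
    then show ?thesis using total by simp
  next
    case False
    then obtain i where i: "i < l" "i \<notin> S" using S by auto
    then have sub: "S \<subseteq> {..<l} - {i}" using S by auto
    \<comment> \<open>\<open>S\<close> has at least \<open>l - 1\<close> elements, as many as the
      set that contains it.\<close>
    have "S = {..<l} - {i}"
      using i S by (intro card_seteq[OF _ sub]) auto
    then show ?thesis using facet[OF i(1)] by simp
  qed
  then have "\<exists>f\<in>polys_deg_le l (l - 2). \<forall>T\<subseteq>{..<l}. set_eval f T = h T"
    by (rule ex_poly_interpolating)
  then obtain f where f: "f \<in> polys_deg_le l (l - 2)"
    and eval: "\<forall>T\<subseteq>{..<l}. set_eval f T = h T"
    by (rule bexE)
  have "set_eval f (zero_set c) = h (zero_set c)" if "c \<in> set cs" for c
  proof (rule eval[rule_format])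
    have "c \<in> carrier_vec l"
      using that assms(2) by (simp add: enumerates_def)
    then show "zero_set c \<subseteq> {..<l}"
      by (auto simp: zero_set_def)
  qed
  then have "map (\<lambda>c. h (zero_set c)) cs = map (\<lambda>c. set_eval f (zero_set c)) cs"
    by simp
  then have "v = vec_of_list (map (\<lambda>c. set_eval f (zero_set c)) cs)"
    by (simp only: h)
  with f show "v \<in> (\<lambda>f. vec_of_list (map (\<lambda>c. set_eval f (zero_set c)) cs)) ` polys_deg_le l (l - 2)"
    by blast
next
  fix v assume "v \<in> (\<lambda>f. vec_of_list (map (\<lambda>c. set_eval f (zero_set c)) cs)) ` polys_deg_le l (l - 2)"
  then obtain f where f: "f \<in> polys_deg_le l (l - 2)"
    and v: "v = vec_of_list (map (\<lambda>c. set_eval f (zero_set c)) cs)" by blast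
  \<comment> \<open>The set without \<open>i\<close> has \<open>l - 1\<close> elements, which
    exceeds the degree bound \<open>l - 2\<close> because \<open>l\<close> is at least 2.\<close>
  have "(\<Sum>T\<in>Pow ({..<l} - {i}). set_eval f T) = 0" if "i < l" for i
    using that assms(1) by (intro sum_set_eval_Pow_eq_0[OF f]) auto
  then show "v \<in> hamming_code l cs"
    unfolding v hamming_code_iff[OF assms(2)] by blast
qed

section \<open>The coordinate permutation\<close>

text \<open>Repetition-free lists with the same entries are rearrangements of each other. The
  direction of \<pi> is the one in \<open>permutation_equivalent\<close>, with \<open>xs\<close>
  indexing the original code.\<close>

lemma ex_permutation_of_image:
  assumes "distinct xs" and "distinct ys" and "inj_on f (set xs)" and "f ` set xs = set ys"
  shows "\<exists>\<pi>. \<pi> permutes {..<length xs} \<and> length ys = length xs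
    \<and> (\<forall>i<length xs. \<pi> i < length xs \<and> ys ! i = f (xs ! \<pi> i))"
proof -
  have "distinct (map f xs)"
    using assms by (simp add: distinct_map)
  then have "mset ys = mset (map f xs)"
    using assms by (subst set_eq_iff_mset_eq_distinct[symmetric]) simp_all
  then obtain \<pi> where \<pi>: "\<pi> permutes {..<length (map f xs)}" "permute_list \<pi> (map f xs) = ys"
    by (rule mset_eq_permutation)
  have n: "\<pi> permutes {..<length xs}" using \<pi>(1) by simp
  have lt: "\<pi> i < length xs" if "i < length xs" for i
    using permutes_in_image[OF n, of i] that by simp
  have "ys ! i = f (xs ! \<pi> i)" if "i < length xs" for i
    using that lt[OF that] by (simp add: \<pi>(2)[symmetric] permute_list_nth[OF \<pi>(1)])
  moreover have "length ys = length xs"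
    using \<pi>(2) by auto
  ultimately show ?thesis using n lt by auto
qed

lemma poly_eval_complement_vec:
  assumes "f \<in> polys_deg_le l j" and "c \<in> carrier_vec l"
  shows "poly_eval f (complement_vec c) = set_eval f (zero_set c)"
proof (rule poly_eval_eq_set_eval)
  fix m i assume "m \<in> Poly_Mapping.keys f" "i \<in> Poly_Mapping.keys m"
  then have "i < l"
    using assms(1) by (auto simp: polys_deg_le_def)
  then show "complement_vec c $ i = (if i \<in> zero_set c then 1 else 0)"
    using assms(2) by (intro complement_vec_index) simp
qed

lemma skeleton_code_carrier: "skeleton_code l j ps \<subseteq> carrier_vec (length ps)"
  unfolding skeleton_code_def by (intro image_subsetI carrier_vecI) simp

text \<open>The permutation comes from the two lists of points alone, so a single \<pi> serves the
  codewords of all polynomials.\<close>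

lemma hamming_code_eq_permuted_skeleton_code:
  assumes "l \<ge> 2"
    and "enumerates ps (skeleton_points l (l - 1))"
    and "enumerates cs (carrier_vec l - {0\<^sub>v l})"
  shows "\<exists>\<pi>. \<pi> permutes {..<length ps} \<and>
    hamming_code l cs = (\<lambda>v. vec (length ps) (\<lambda>i. v $ \<pi> i)) ` skeleton_code l (l - 2) ps"
proof -
  let ?n = "length ps"
  have dist: "distinct ps" "distinct cs" and set_cs: "set cs = carrier_vec l - {0\<^sub>v l}"
    and set_ps: "set ps = skeleton_points l (l - 1)"
    using assms(2,3) by (simp_all only: enumerates_def)
  have inj: "inj_on complement_vec (set ps)"
    by (metis complement_vec_involution inj_onI)
  have "complement_vec ` set ps = set cs"
    unfolding set_ps set_cs using assms(1) by (intro complement_skeleton_points) simp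
  then have "\<exists>\<pi>. \<pi> permutes {..<?n} \<and> length cs = ?n
      \<and> (\<forall>i<?n. \<pi> i < ?n \<and> cs ! i = complement_vec (ps ! \<pi> i))"
    by (rule ex_permutation_of_image[OF dist inj])
  then obtain \<pi> where perm: "\<pi> permutes {..<?n}" and len: "length cs = ?n"
    and nth: "\<And>i. i < ?n \<Longrightarrow> \<pi> i < ?n \<and> cs ! i = complement_vec (ps ! \<pi> i)"
    by blast
  \<comment> \<open>Entry \<open>i\<close> on the left is the value of \<open>f\<close> at
    \<open>ps ! \<pi> i\<close>. Since complementation is an involution, this point is the
    complement of \<open>cs ! i\<close>, with support \<open>zero_set (cs ! i)\<close>.\<close>
  have "vec ?n (\<lambda>i. vec_of_list (map (poly_eval f) ps) $ \<pi> i)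
      = vec_of_list (map (\<lambda>c. set_eval f (zero_set c)) cs)"
    if f: "f \<in> polys_deg_le l (l - 2)" for f
  proof (rule eq_vecI)
    fix i assume "i < dim_vec (vec_of_list (map (\<lambda>c. set_eval f (zero_set c)) cs))"
    then have i: "i < ?n" by (simp add: len)
    then have "cs ! i \<in> carrier_vec l"
      using set_cs len by (metis Diff_iff nth_mem)
    then have "set_eval f (zero_set (cs ! i)) = poly_eval f (ps ! \<pi> i)"
      using poly_eval_complement_vec[OF f] nth[OF i] by (metis complement_vec_involution)
    then show "vec ?n (\<lambda>i. vec_of_list (map (poly_eval f) ps) $ \<pi> i) $ i
      = vec_of_list (map (\<lambda>c. set_eval f (zero_set c)) cs) $ i"
      using i nth[OF i] by (simp add: vec_of_list_index len)
  qed (simp add: len)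
  then have "hamming_code l cs
      = (\<lambda>v. vec ?n (\<lambda>i. v $ \<pi> i)) ` skeleton_code l (l - 2) ps"
    unfolding hamming_code_eq_evaluations[OF assms(1,3)] skeleton_code_def image_image
    by (intro image_cong refl) simp
  with perm show ?thesis by (intro exI conjI)
qed

theorem proposition4p1:
  fixes l :: nat and ps cs :: "bit vec list"
  assumes "l \<ge> 2"
    and "enumerates ps (skeleton_points l (l - 1))"
    and "enumerates cs (carrier_vec l - {0\<^sub>v l})"
  shows "permutation_equivalent (skeleton_code l (l - 2) ps) (hamming_code l cs)"
proof -
  obtain \<pi> where "\<pi> permutes {..<length ps}"
    and eq: "hamming_code l cs = (\<lambda>v. vec (length ps) (\<lambda>i. v $ \<pi> i)) ` skeleton_code l (l - 2) ps"
    using hamming_code_eq_permuted_skeleton_code[OF assms] by (elim exE conjE)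
  moreover have "hamming_code l cs \<subseteq> carrier_vec (length ps)"
    unfolding eq by (intro image_subsetI vec_carrier)
  ultimately show ?thesis
    unfolding permutation_equivalent_def using skeleton_code_carrier by (intro exI conjI)
qed

end
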